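(* Let $(G,\sigma)$ and $(H,\sigma')$ be finite simple graphs with linear orderings of their vertex sets, and let $FF(G,\sigma)=p$ and $FF(H,\sigma')=q$. Then $FF(G\Box H,\mathrm{lex})=FF(K_p\Box K_q,\mathrm{lex})$.
   Context: $G\Box H$ is the Cartesian product: vertex set $V(G)\times V(H)$, with $(u,v)\sim(u',v')$ iff either $u=u'$ and $vv'\in E(H)$, or $uu'\in E(G)$ and $v=v'$. $K_n$ is the complete graph on $n$ vertices. The First-Fit coloring with respect to a vertex ordering scans vertices in order and gives each the smallest positive integer not used on its previously colored neighbors; $FF$ denotes the number of colors used. The lexicographic ordering $\mathrm{lex}$ of $V(G\Box H)$ induced by $\sigma,\sigma'$: $(u,v)$ precedes $(u',v')$ iff $\sigma(u)<\sigma(u')$, or $u=u'$ and $\sigma'(v)<\sigma'(v')$. For $K_p\Box K_q$, $\mathrm{lex}$ is induced by any orderings of the (interchangeable) vertices of $K_p$ and $K_q$. *)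

theory Defs
  imports "Graph_Theory.Graph_Theory"
begin

text \<open>
  A finite simple graph is a \<^const>\<open>pair_graph\<close>: an undirected edge $uv$ is the pair of arcs
  $(u,v)$ and $(v,u)$.  A linear ordering of the vertices is a repetition-free list enumerating
  them; $\sigma(u)$ is the position of $u$ in that list.
\<close>

definition vertex_ordering :: "'a pair_pre_digraph \<Rightarrow> 'a list \<Rightarrow> bool" where
  "vertex_ordering G \<sigma> \<longleftrightarrow> distinct \<sigma> \<and> set \<sigma> = pverts G"

definition precedes :: "'a list \<Rightarrow> 'a \<Rightarrow> 'a \<Rightarrow> bool" where
  "precedes \<sigma> x y \<longleftrightarrow> (\<exists>i j. i < j \<and> j < length \<sigma> \<and> \<sigma> ! i = x \<and> \<sigma> ! j = y)"

definition cartesian_product ::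
    "'a pair_pre_digraph \<Rightarrow> 'b pair_pre_digraph \<Rightarrow> ('a \<times> 'b) pair_pre_digraph" (infixr \<open>\<box>\<close> 70) where
  "G \<box> H =
    \<lparr> pverts = pverts G \<times> pverts H,
      parcs = {((u, v), (u', v')) | u v u' v'.
        (u = u' \<and> u \<in> pverts G \<and> (v, v') \<in> parcs H) \<or>
        ((u, u') \<in> parcs G \<and> v = v' \<and> v \<in> pverts H)} \<rparr>"

text \<open>Uncoloured vertices are mapped to \<^const>\<open>None\<close>.\<close>

definition first_fit_step ::
    "'a pair_pre_digraph \<Rightarrow> 'a \<Rightarrow> ('a \<rightharpoonup> nat) \<Rightarrow> ('a \<rightharpoonup> nat)" where
  "first_fit_step G v c = c(v \<mapsto> (LEAST k. 0 < k \<and> (\<forall>u. (u, v) \<in> parcs G \<longrightarrow> c u \<noteq> Some k)))"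

definition first_fit :: "'a pair_pre_digraph \<Rightarrow> 'a list \<Rightarrow> ('a \<rightharpoonup> nat)" where
  "first_fit G \<sigma> = fold (first_fit_step G) \<sigma> Map.empty"

definition FF :: "'a pair_pre_digraph \<Rightarrow> 'a list \<Rightarrow> nat" where
  "FF G \<sigma> = card (ran (first_fit G \<sigma>))"

text \<open>That this list is the lexicographic ordering is \<open>precedes_lex_ordering\<close> below.\<close>

definition lex_ordering :: "'a list \<Rightarrow> 'b list \<Rightarrow> ('a \<times> 'b) list" where
  "lex_ordering \<sigma> \<sigma>' = List.product \<sigma> \<sigma>'"

lemma pair_graph_cartesian_product:
  assumes "pair_graph G" and "pair_graph H"
  shows "pair_graph (G \<box> H)"
proof -
  interpret G: pair_graph G by fact
  interpret H: pair_graph H by fact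
  have sub: "parcs (G \<box> H) \<subseteq> (pverts G \<times> pverts H) \<times> (pverts G \<times> pverts H)"
    by (auto simp: cartesian_product_def dest: G.wellformed' H.wellformed')
  have fin: "finite (parcs (G \<box> H))"
    by (rule finite_subset[OF sub]) (simp add: G.pair_finite_verts H.pair_finite_verts)
  have "sym (parcs (G \<box> H))"
    by (rule symI) (auto simp: cartesian_product_def dest: G.arcs_symmetric H.arcs_symmetric)
  then show ?thesis
    using sub fin
    by unfold_locales
      (auto simp: symmetric_def cartesian_product_def G.pair_finite_verts H.pair_finite_verts
        intro: G.wellformed' H.wellformed' dest: G.no_loops' H.no_loops')
qed

lemma vertex_ordering_lex_ordering:
  assumes "vertex_ordering G \<sigma>" and "vertex_ordering H \<sigma>'"
  shows "vertex_ordering (G \<box> H) (lex_ordering \<sigma> \<sigma>')"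
  using assms
  by (simp add: vertex_ordering_def lex_ordering_def cartesian_product_def distinct_product)

lemma precedes_Nil [simp]: "\<not> precedes [] x y"
  by (simp add: precedes_def)

lemma precedes_Cons: "precedes (z # zs) x y \<longleftrightarrow> (x = z \<and> y \<in> set zs) \<or> precedes zs x y"
proof
  assume "precedes (z # zs) x y"
  then obtain i j where ij: "i < j" "j < length (z # zs)" "(z # zs) ! i = x" "(z # zs) ! j = y"
    unfolding precedes_def by blast
  then obtain j' where "j = Suc j'" by (cases j) auto
  with ij show "(x = z \<and> y \<in> set zs) \<or> precedes zs x y"
    by (cases i) (auto simp: precedes_def)
next
  assume "(x = z \<and> y \<in> set zs) \<or> precedes zs x y"
  then show "precedes (z # zs) x y"
  proof
    assume "x = z \<and> y \<in> set zs"
    then obtain j where "x = z" "j < length zs" "zs ! j = y" by (auto simp: in_set_conv_nth)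
    then show ?thesis
      unfolding precedes_def by (intro exI[of _ 0] exI[of _ "Suc j"]) simp
  next
    assume "precedes zs x y"
    then obtain i j where "i < j" "j < length zs" "zs ! i = x" "zs ! j = y"
      unfolding precedes_def by blast
    then show ?thesis
      unfolding precedes_def by (intro exI[of _ "Suc i"] exI[of _ "Suc j"]) simp
  qed
qed

lemma precedes_append:
  "precedes (xs @ ys) x y \<longleftrightarrow> precedes xs x y \<or> precedes ys x y \<or> (x \<in> set xs \<and> y \<in> set ys)"
  by (induction xs) (auto simp: precedes_Cons)

lemma precedes_imp_mem: "precedes xs x y \<Longrightarrow> x \<in> set xs \<and> y \<in> set xs"
  by (auto simp: precedes_def)

lemma precedes_map_Pair:
  "precedes (map (Pair a) ys) (u, v) (u', v') \<longleftrightarrow> u = a \<and> u' = a \<and> precedes ys v v'"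
  by (induction ys) (auto simp: precedes_Cons)

lemma precedes_lex_ordering:
  assumes "distinct \<sigma>" and "u \<in> set \<sigma>" "u' \<in> set \<sigma>" and "v \<in> set \<sigma>'" "v' \<in> set \<sigma>'"
  shows "precedes (lex_ordering \<sigma> \<sigma>') (u, v) (u', v') \<longleftrightarrow>
    precedes \<sigma> u u' \<or> (u = u' \<and> precedes \<sigma>' v v')"
proof -
  have "precedes (List.product \<sigma> \<sigma>') (u, v) (u', v') \<longleftrightarrow>
      precedes \<sigma> u u' \<or> (u \<in> set \<sigma> \<and> u = u' \<and> precedes \<sigma>' v v')"
    using \<open>distinct \<sigma>\<close>
    by (induction \<sigma>)
      (use assms(4,5) in \<open>auto simp: precedes_Cons precedes_append precedes_map_Pair
        dest: precedes_imp_mem\<close>)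
  then show ?thesis using assms(2) by (simp add: lex_ordering_def)
qed

end

theory Submission
  imports Defs
begin

text \<open>
  Let $f(i,j)$ be the least positive integer different from all $f(i',j)$ with $0 < i' < i$ and all
  $f(i,j')$ with $0 < j' < j$ (nim addition, shifted by one).  If $c$ and $d$ are the First-Fit
  colourings of $G$ and $H$, then $f(c(u),d(v))$ is the First-Fit colouring of $G \Box H$: the
  neighbours preceding $(u,v)$ exhibit all the pairs $(i',d(v))$ with $i' < c(u)$ and $(c(u),j')$
  with $j' < d(v)$, and every further pair they exhibit differs from $(c(u),d(v))$ in exactly one
  coordinate, hence has a different value because $f$ is injective in each argument.  So
  $FF(G \Box H)$ is the number of values of $f$ on $[1,p] \times [1,q]$, and First-Fit uses
  exactly $n$ colours on $K_n$.
\<close>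

section \<open>Characterising First-Fit colourings without recursion\<close>

text \<open>With this order-based description, a formula is identified as the First-Fit colouring by
  checking three conditions instead of running the algorithm along the list.\<close>

definition greedy_coloring :: "'a pair_pre_digraph \<Rightarrow> 'a list \<Rightarrow> ('a \<Rightarrow> nat) \<Rightarrow> bool" where
  "greedy_coloring G \<sigma> c \<longleftrightarrow>
    (\<forall>v\<in>set \<sigma>. 0 < c v) \<and>
    (\<forall>u v. precedes \<sigma> u v \<and> (u, v) \<in> parcs G \<longrightarrow> c u \<noteq> c v) \<and>
    (\<forall>v\<in>set \<sigma>. \<forall>k. 0 < k \<and> k < c v \<longrightarrow> (\<exists>u. precedes \<sigma> u v \<and> (u, v) \<in> parcs G \<and> c u = k))"

lemma precedes_snoc: "precedes (xs @ [x]) u v \<longleftrightarrow> precedes xs u v \<or> (u \<in> set xs \<and> v = x)"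
  by (simp add: precedes_append precedes_Cons)

text \<open>First-Fit colours the last vertex last. As \<open>x\<close> is new, it precedes nothing
  in \<open>xs\<close>, so the conditions on \<open>xs\<close> are unchanged, while all of
  \<open>xs\<close> precedes \<open>x\<close>.\<close>

lemma greedy_coloring_snoc:
  assumes "x \<notin> set xs"
  shows "greedy_coloring G (xs @ [x]) c \<longleftrightarrow>
    greedy_coloring G xs c \<and> 0 < c x \<and>
    (\<forall>u\<in>set xs. (u, x) \<in> parcs G \<longrightarrow> c u \<noteq> c x) \<and>
    (\<forall>k. 0 < k \<and> k < c x \<longrightarrow> (\<exists>u\<in>set xs. (u, x) \<in> parcs G \<and> c u = k))"
proof -
  have 1: "v \<noteq> x" if "precedes xs u v" for u v
    using that assms precedes_imp_mem by metis
  have 2: "v \<noteq> x" if "v \<in> set xs" for v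
    using that assms by blast
  have "(\<forall>u v. precedes (xs @ [x]) u v \<and> (u, v) \<in> parcs G \<longrightarrow> c u \<noteq> c v) \<longleftrightarrow>
      (\<forall>u v. precedes xs u v \<and> (u, v) \<in> parcs G \<longrightarrow> c u \<noteq> c v) \<and>
      (\<forall>u\<in>set xs. (u, x) \<in> parcs G \<longrightarrow> c u \<noteq> c x)"
    unfolding precedes_snoc by blast
  moreover have "(\<exists>u. precedes (xs @ [x]) u v \<and> (u, v) \<in> parcs G \<and> c u = k) \<longleftrightarrow>
      (\<exists>u. precedes xs u v \<and> (u, v) \<in> parcs G \<and> c u = k)" if "v \<in> set xs" for v k
    using 2[OF that] unfolding precedes_snoc by blast
  moreover have "(\<exists>u. precedes (xs @ [x]) u x \<and> (u, x) \<in> parcs G \<and> c u = k) \<longleftrightarrow>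
      (\<exists>u\<in>set xs. (u, x) \<in> parcs G \<and> c u = k)" for k
    using 1 unfolding precedes_snoc by blast
  ultimately show ?thesis
    unfolding greedy_coloring_def by (simp add: ball_Un) argo
qed

lemma first_fit_eq_greedy_coloring:
  assumes "distinct \<sigma>" and "greedy_coloring G \<sigma> c"
  shows "first_fit G \<sigma> = (\<lambda>v. if v \<in> set \<sigma> then Some (c v) else None)"
  using assms
proof (induction \<sigma> rule: rev_induct)
  case Nil
  then show ?case by (simp add: first_fit_def)
next
  case (snoc x xs)
  then have x: "x \<notin> set xs" by simp
  note c = snoc.prems(2)[unfolded greedy_coloring_snoc[OF x]]
  have IH: "first_fit G xs = (\<lambda>v. if v \<in> set xs then Some (c v) else None)"
    using snoc c by simp
  \<comment> \<open>Vertices outside \<open>xs\<close>, among them \<open>x\<close> itself, are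
    still mapped to \<open>None\<close> and forbid no colour. Hence the colours to avoid come only
    from neighbours in \<open>xs\<close>.\<close>
  have "(LEAST k. 0 < k \<and> (\<forall>u. (u, x) \<in> parcs G \<longrightarrow> first_fit G xs u \<noteq> Some k)) = c x"
  proof (rule Least_equality)
    show "0 < c x \<and> (\<forall>u. (u, x) \<in> parcs G \<longrightarrow> first_fit G xs u \<noteq> Some (c x))"
      using c by (simp add: IH)
  next
    fix k assume "0 < k \<and> (\<forall>u. (u, x) \<in> parcs G \<longrightarrow> first_fit G xs u \<noteq> Some k)"
    then have "0 < k" "\<not> (\<exists>u\<in>set xs. (u, x) \<in> parcs G \<and> c u = k)"
      by (auto simp: IH)
    then show "c x \<le> k"
      using c not_le by blast
  qed
  then have "first_fit G (xs @ [x]) = (first_fit G xs)(x \<mapsto> c x)"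
    by (simp add: first_fit_def first_fit_step_def)
  then show ?case
    by (auto simp: IH fun_eq_iff)
qed

lemma ex_least_pos_not_mem:
  fixes A :: "nat set"
  assumes "finite A"
  obtains m where "0 < m" "m \<notin> A" "\<And>k. 0 < k \<Longrightarrow> k < m \<Longrightarrow> k \<in> A"
proof -
  \<comment> \<open>Inserting 0 forces the fresh number to be positive, so the least element taken
    below exists.\<close>
  obtain n where "n \<notin> insert 0 A"
    using assms ex_new_if_finite[OF infinite_UNIV_nat] by blast
  then have ex: "0 < n \<and> n \<notin> A" by simp
  show thesis
    using that LeastI[of "\<lambda>k. 0 < k \<and> k \<notin> A", OF ex] not_less_Least[of _ "\<lambda>k. 0 < k \<and> k \<notin> A"]
    by blast
qed

lemma ex_greedy_coloring:
  assumes "distinct \<sigma>"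
  obtains c where "greedy_coloring G \<sigma> c"
proof -
  have "\<exists>c. greedy_coloring G \<sigma> c"
    using assms
  proof (induction \<sigma> rule: rev_induct)
    case Nil
    then show ?case by (simp add: greedy_coloring_def)
  next
    case (snoc x xs)
    then obtain c where c: "greedy_coloring G xs c" and x: "x \<notin> set xs" by auto
    \<comment> \<open>The value \<open>m\<close> is the First-Fit choice for \<open>x\<close>.
      Overwriting \<open>c\<close> at \<open>x\<close> does not disturb the colours on
      \<open>xs\<close>.\<close>
    obtain m where m: "0 < m" "m \<notin> c ` {u \<in> set xs. (u, x) \<in> parcs G}"
      "\<And>k. 0 < k \<Longrightarrow> k < m \<Longrightarrow> k \<in> c ` {u \<in> set xs. (u, x) \<in> parcs G}"
      using ex_least_pos_not_mem[of "c ` {u \<in> set xs. (u, x) \<in> parcs G}"] by auto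
    have upd: "(c(x := m)) u = c u" if "u \<in> set xs" for u
      using that x by auto
    have "greedy_coloring G xs (c(x := m))"
      using c upd unfolding greedy_coloring_def by (metis precedes_imp_mem)
    moreover have "\<exists>u\<in>set xs. (u, x) \<in> parcs G \<and> (c(x := m)) u = k" if "0 < k" "k < m" for k
      using m(3)[OF that] upd by auto
    moreover have "(c(x := m)) u \<noteq> m" if "u \<in> set xs" "(u, x) \<in> parcs G" for u
      using m(2) that upd by auto
    ultimately have "greedy_coloring G (xs @ [x]) (c(x := m))"
      using m(1) unfolding greedy_coloring_snoc[OF x] by simp
    then show ?case by blast
  qed
  then show thesis using that by blast
qed

lemma FF_eq_card_image:
  assumes "distinct \<sigma>" and "greedy_coloring G \<sigma> c"
  shows "FF G \<sigma> = card (c ` set \<sigma>)"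
proof -
  have "ran (first_fit G \<sigma>) = c ` set \<sigma>"
    unfolding first_fit_eq_greedy_coloring[OF assms] by (auto simp: ran_def)
  then show ?thesis by (simp add: FF_def)
qed

lemma downward_closed_eq_atLeastAtMost_card:
  fixes A :: "nat set"
  assumes "finite A" and "0 \<notin> A" and down: "\<And>k m. m \<in> A \<Longrightarrow> 0 < k \<Longrightarrow> k < m \<Longrightarrow> k \<in> A"
  shows "A = {1..card A}"
proof (cases "A = {}")
  case False
  have "A = {1..Max A}"
  proof
    show "A \<subseteq> {1..Max A}"
    proof
      fix m assume "m \<in> A"
      then show "m \<in> {1..Max A}"
        using assms(1,2) by (cases m) auto
    qed
    show "{1..Max A} \<subseteq> A"
    proof
      fix k assume "k \<in> {1..Max A}"
      then show "k \<in> A"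
        using down[OF Max_in[OF assms(1) False], of k] Max_in[OF assms(1) False]
        by (cases "k = Max A") auto
    qed
  qed
  moreover from this have "card A = Max A"
    using card_atLeastAtMost[of 1 "Max A"] by simp
  ultimately show ?thesis by simp
qed simp

text \<open>A used colour brings with it every smaller positive colour, on an earlier neighbour. So
  the colours have no gaps, and their number determines the set of them.\<close>

lemma greedy_coloring_image:
  assumes "distinct \<sigma>" and c: "greedy_coloring G \<sigma> c"
  shows "c ` set \<sigma> = {1..FF G \<sigma>}"
proof -
  have "c ` set \<sigma> = {1..card (c ` set \<sigma>)}"
  proof (rule downward_closed_eq_atLeastAtMost_card)
    show "0 \<notin> c ` set \<sigma>"
      using c by (force simp: greedy_coloring_def)
  next
    fix k m assume "m \<in> c ` set \<sigma>" and k: "0 < k" "k < m"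
    then obtain v where "v \<in> set \<sigma>" "k < c v" by auto
    then obtain u where "precedes \<sigma> u v" "c u = k"
      using c k(1) unfolding greedy_coloring_def by blast
    then show "k \<in> c ` set \<sigma>"
      using precedes_imp_mem[of \<sigma> u v] by blast
  qed simp
  then show ?thesis
    by (simp add: FF_eq_card_image[OF assms])
qed

section \<open>The shifted nim sum\<close>

text \<open>Termination relies on the congruence rule for images, which supplies the bounds on the
  recursive arguments. The ranges start above 0 because colours do.\<close>

fun shifted_nim_sum :: "nat \<Rightarrow> nat \<Rightarrow> nat" where
  "shifted_nim_sum i j =
    (LEAST k. 0 < k \<and> k \<notin> (\<lambda>i'. shifted_nim_sum i' j) ` {0<..<i} \<union> shifted_nim_sum i ` {0<..<j})"

text \<open>The unconditional recursive equation would make the simplifier loop.\<close>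

declare shifted_nim_sum.simps [simp del]

text \<open>These facts unpack the \<open>LEAST\<close> once; they supply, in turn, positivity,
  properness and the witnesses for smaller colours in the product.\<close>

lemma shifted_nim_sum_pos: "0 < shifted_nim_sum i j"
  and shifted_nim_sum_not_mem:
    "shifted_nim_sum i j \<notin> (\<lambda>i'. shifted_nim_sum i' j) ` {0<..<i} \<union> shifted_nim_sum i ` {0<..<j}"
  and shifted_nim_sum_mem:
    "0 < k \<Longrightarrow> k < shifted_nim_sum i j \<Longrightarrow>
      k \<in> (\<lambda>i'. shifted_nim_sum i' j) ` {0<..<i} \<union> shifted_nim_sum i ` {0<..<j}"
proof -
  define A where
    "A = (\<lambda>i'. shifted_nim_sum i' j) ` {0<..<i} \<union> shifted_nim_sum i ` {0<..<j}"
  have eq: "shifted_nim_sum i j = (LEAST k. 0 < k \<and> k \<notin> A)"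
    unfolding A_def by (rule shifted_nim_sum.simps)
  obtain m where m: "0 < m" "m \<notin> A" "\<And>k. 0 < k \<Longrightarrow> k < m \<Longrightarrow> k \<in> A"
    using ex_least_pos_not_mem[of A] by (auto simp: A_def)
  have "shifted_nim_sum i j = m"
    unfolding eq by (rule Least_equality) (use m not_le in blast)+
  with m show "0 < shifted_nim_sum i j" "shifted_nim_sum i j \<notin> A"
    "0 < k \<Longrightarrow> k < shifted_nim_sum i j \<Longrightarrow> k \<in> A"
    by auto
qed

text \<open>The value at the larger index avoids the values at all smaller positive ones. Positivity
  matters: the indices 0 and 1 give the same value.\<close>

lemma shifted_nim_sum_left_cancel:
  assumes "0 < i" "0 < i'" "shifted_nim_sum i j = shifted_nim_sum i' j"
  shows "i = i'"
proof (rule ccontr)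
  have neq: "shifted_nim_sum a j \<noteq> shifted_nim_sum b j" if "0 < a" "a < b" for a b
  proof -
    have "a \<in> {0<..<b}" using that by simp
    then have "shifted_nim_sum a j \<in> (\<lambda>i'. shifted_nim_sum i' j) ` {0<..<b}" by (rule imageI)
    then show ?thesis using shifted_nim_sum_not_mem[of b j] by (metis UnI1)
  qed
  assume "i \<noteq> i'"
  then show False
    using assms neq[of i i'] neq[of i' i] by (simp add: neq_iff) metis
qed

lemma shifted_nim_sum_right_cancel:
  assumes "0 < j" "0 < j'" "shifted_nim_sum i j = shifted_nim_sum i j'"
  shows "j = j'"
proof (rule ccontr)
  have neq: "shifted_nim_sum i a \<noteq> shifted_nim_sum i b" if "0 < a" "a < b" for a b
  proof -
    have "a \<in> {0<..<b}" using that by simp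
    then have "shifted_nim_sum i a \<in> shifted_nim_sum i ` {0<..<b}" by (rule imageI)
    then show ?thesis using shifted_nim_sum_not_mem[of i b] by (metis UnI2)
  qed
  assume "j \<noteq> j'"
  then show False
    using assms neq[of j j'] neq[of j' j] by (simp add: neq_iff) metis
qed

section \<open>First-Fit on Cartesian products\<close>

lemma parcs_cartesian_product:
  "((u, v), (u', v')) \<in> parcs (G \<box> H) \<longleftrightarrow>
    (u = u' \<and> u \<in> pverts G \<and> (v, v') \<in> parcs H) \<or> ((u, u') \<in> parcs G \<and> v = v' \<and> v \<in> pverts H)"
  by (simp add: cartesian_product_def)

lemma precedes_irrefl: "distinct \<sigma> \<Longrightarrow> \<not> precedes \<sigma> v v"
  by (auto simp: precedes_def nth_eq_iff_index_eq)

lemma set_lex_ordering: "set (lex_ordering \<sigma> \<sigma>') = set \<sigma> \<times> set \<sigma>'"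
  by (simp add: lex_ordering_def)

lemma greedy_coloring_cartesian_product:
  assumes \<sigma>: "vertex_ordering G \<sigma>" and \<sigma>': "vertex_ordering H \<sigma>'"
    and c: "greedy_coloring G \<sigma> c" and d: "greedy_coloring H \<sigma>' d"
  shows "greedy_coloring (G \<box> H) (lex_ordering \<sigma> \<sigma>') (\<lambda>(u, v). shifted_nim_sum (c u) (d v))"
proof -
  have dist: "distinct \<sigma>" "distinct \<sigma>'" and verts: "set \<sigma> = pverts G" "set \<sigma>' = pverts H"
    using \<sigma> \<sigma>' by (auto simp: vertex_ordering_def)
  have pos: "\<And>u. u \<in> set \<sigma> \<Longrightarrow> 0 < c u" "\<And>v. v \<in> set \<sigma>' \<Longrightarrow> 0 < d v"
    using c d by (auto simp: greedy_coloring_def)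
  have proper: "shifted_nim_sum (c u) (d v) \<noteq> shifted_nim_sum (c u') (d v')"
    if prec: "precedes (lex_ordering \<sigma> \<sigma>') (u, v) (u', v')"
      and arc: "((u, v), (u', v')) \<in> parcs (G \<box> H)" for u v u' v'
  proof -
    have mem: "u \<in> set \<sigma>" "u' \<in> set \<sigma>" "v \<in> set \<sigma>'" "v' \<in> set \<sigma>'"
      using precedes_imp_mem[OF prec] by (auto simp: set_lex_ordering)
    have prec': "precedes \<sigma> u u' \<or> u = u' \<and> precedes \<sigma>' v v'"
      using prec precedes_lex_ordering[OF dist(1) mem] by simp
    from arc[unfolded parcs_cartesian_product] show ?thesis
    proof (elim disjE conjE)
      \<comment> \<open>Since nothing precedes itself, equal first coordinates leave only
        \<open>v\<close> preceding \<open>v'\<close>, and \<open>d\<close> is proper there.\<close>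
      assume "u = u'" "(v, v') \<in> parcs H"
      then have "d v \<noteq> d v'"
        using prec' precedes_irrefl[OF dist(1)] d by (auto simp: greedy_coloring_def)
      then show ?thesis
        using \<open>u = u'\<close> pos(2) mem shifted_nim_sum_right_cancel by metis
    next
      assume "(u, u') \<in> parcs G" "v = v'"
      then have "c u \<noteq> c u'"
        using prec' precedes_irrefl[OF dist(2)] c by (auto simp: greedy_coloring_def)
      then show ?thesis
        using \<open>v = v'\<close> pos(1) mem shifted_nim_sum_left_cancel by metis
    qed
  qed
  have greedy: "\<exists>u' v'. precedes (lex_ordering \<sigma> \<sigma>') (u', v') (u, v) \<and>
      ((u', v'), (u, v)) \<in> parcs (G \<box> H) \<and> shifted_nim_sum (c u') (d v') = k"
    if mem: "u \<in> set \<sigma>" "v \<in> set \<sigma>'" and k: "0 < k" "k < shifted_nim_sum (c u) (d v)" for u v k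
    \<comment> \<open>A smaller value \<open>k\<close> arises by lowering exactly one argument. The
      lowered argument is the colour of an earlier neighbour in that factor, and replacing that
      coordinate gives the witness.\<close>
    using shifted_nim_sum_mem[OF k]
  proof
    assume "k \<in> (\<lambda>i'. shifted_nim_sum i' (d v)) ` {0<..<c u}"
    then obtain i where i: "0 < i" "i < c u" "k = shifted_nim_sum i (d v)" by auto
    then obtain u' where u': "precedes \<sigma> u' u" "(u', u) \<in> parcs G" "c u' = i"
      using c mem unfolding greedy_coloring_def by metis
    moreover have "u' \<in> set \<sigma>" using precedes_imp_mem[OF u'(1)] by simp
    ultimately show ?thesis
      using i mem verts precedes_lex_ordering[OF dist(1), of u' u v \<sigma>' v] parcs_cartesian_product
      by metis
  next
    assume "k \<in> shifted_nim_sum (c u) ` {0<..<d v}"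
    then obtain j where j: "0 < j" "j < d v" "k = shifted_nim_sum (c u) j" by auto
    then obtain v' where v': "precedes \<sigma>' v' v" "(v', v) \<in> parcs H" "d v' = j"
      using d mem unfolding greedy_coloring_def by metis
    moreover have "v' \<in> set \<sigma>'" using precedes_imp_mem[OF v'(1)] by simp
    ultimately show ?thesis
      using j mem verts precedes_lex_ordering[OF dist(1), of u u v' \<sigma>' v] parcs_cartesian_product
      by metis
  qed
  show ?thesis
    unfolding greedy_coloring_def set_lex_ordering
    using proper greedy by (auto simp: shifted_nim_sum_pos)
qed

text \<open>The right-hand side sees the graphs and orderings only through their First-Fit numbers,
  which is why complete graphs can replace them.\<close>

lemma FF_cartesian_product:
  assumes \<sigma>: "vertex_ordering G \<sigma>" and \<sigma>': "vertex_ordering H \<sigma>'"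
  shows "FF (G \<box> H) (lex_ordering \<sigma> \<sigma>') =
    card ((\<lambda>(i, j). shifted_nim_sum i j) ` ({1..FF G \<sigma>} \<times> {1..FF H \<sigma>'}))"
proof -
  have dist: "distinct \<sigma>" "distinct \<sigma>'" "distinct (lex_ordering \<sigma> \<sigma>')"
    using vertex_ordering_lex_ordering[OF assms] assms by (auto simp: vertex_ordering_def)
  obtain c where c: "greedy_coloring G \<sigma> c"
    using ex_greedy_coloring[OF dist(1)] .
  obtain d where d: "greedy_coloring H \<sigma>' d"
    using ex_greedy_coloring[OF dist(2)] .
  \<comment> \<open>Passing from vertices to colours turns the domain into a product of two colour
    sets, each an interval by \<open>greedy_coloring_image\<close>.\<close>
  have "(\<lambda>(u, v). shifted_nim_sum (c u) (d v)) ` (set \<sigma> \<times> set \<sigma>') =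
      (\<lambda>(i, j). shifted_nim_sum i j) ` (c ` set \<sigma> \<times> d ` set \<sigma>')"
    by force
  then show ?thesis
    using FF_eq_card_image[OF dist(3) greedy_coloring_cartesian_product[OF assms c d]]
    by (simp add: set_lex_ordering greedy_coloring_image[OF dist(1) c]
        greedy_coloring_image[OF dist(2) d])
qed

section \<open>Complete graphs and the conclusion\<close>

lemma FF_complete_digraph:
  assumes K: "complete_digraph n (with_proj K)" and \<tau>: "vertex_ordering K \<tau>"
  shows "FF K \<tau> = n"
proof -
  have dist: "distinct \<tau>" and verts: "set \<tau> = pverts K"
    using \<tau> by (simp_all add: vertex_ordering_def)
  have card: "card (pverts K) = n"
    and parcs: "parcs K = {(u, v). (u, v) \<in> pverts K \<times> pverts K \<and> u \<noteq> v}"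
    using K unfolding complete_digraph_pair_def by blast+
  obtain c where c: "greedy_coloring K \<tau> c"
    using ex_greedy_coloring[OF dist] .
  \<comment> \<open>Of two distinct vertices one precedes the other, and arcs run both ways, so
    properness separates their colours whichever comes first.\<close>
  have "inj_on c (set \<tau>)"
  proof (rule inj_onI, rule ccontr)
    fix u v assume uv: "u \<in> set \<tau>" "v \<in> set \<tau>" "c u = c v" "u \<noteq> v"
    then have "precedes \<tau> u v \<or> precedes \<tau> v u"
      unfolding precedes_def by (metis in_set_conv_nth linorder_neqE_nat)
    moreover have "(u, v) \<in> parcs K" "(v, u) \<in> parcs K"
      unfolding parcs using uv verts by auto
    ultimately show False
      using uv(3) c unfolding greedy_coloring_def by metis
  qed
  then show ?thesis
    using FF_eq_card_image[OF dist c] verts card by (simp add: card_image)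
qed

theorem theorem3:
  fixes G :: "'a pair_pre_digraph" and H :: "'b pair_pre_digraph"
    and Kp :: "'c pair_pre_digraph" and Kq :: "'d pair_pre_digraph"
    and \<sigma> :: "'a list" and \<sigma>' :: "'b list" and \<tau> :: "'c list" and \<tau>' :: "'d list"
    and p q :: nat
  assumes "pair_graph G" and "vertex_ordering G \<sigma>"
    and "pair_graph H" and "vertex_ordering H \<sigma>'"
    and "FF G \<sigma> = p" and "FF H \<sigma>' = q"
    and "complete_digraph p (with_proj Kp)" and "vertex_ordering Kp \<tau>"
    and "complete_digraph q (with_proj Kq)" and "vertex_ordering Kq \<tau>'"
  shows "FF (G \<box> H) (lex_ordering \<sigma> \<sigma>') = FF (Kp \<box> Kq) (lex_ordering \<tau> \<tau>')"
  \<comment> \<open>Both sides count the values of \<open>shifted_nim_sum\<close> on the same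
    rectangle, with sides \<open>p\<close> and \<open>q\<close>.\<close>
  using FF_cartesian_product[OF assms(2,4)] FF_cartesian_product[OF assms(8,10)]
    FF_complete_digraph[OF assms(7,8)] FF_complete_digraph[OF assms(9,10)] assms(5,6)
  by simp

end
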